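(* There is no datatype defining rewrite system (DDRS) for the canonical term algebra $\widehat{\mathbb Q_0}$, and there is no DDRS for the canonical term algebra $\widehat{\mathbb Q_{\mathbf a}}$.
   Context: DDRS. A datatype defining rewrite system (DDRS) over a given signature is a finite set $E$ of equations between terms (with variables) over that signature which, when each equation is oriented from left to right, is a ground complete term rewriting system: rewriting of closed terms is terminating and confluent, so every closed term has a unique normal form. Its canonical term algebra is the algebra over the signature whose domain is the set of closed normal forms, where an operation applied to normal forms yields the normal form of the resulting term. $E$ is a DDRS for a given canonical term algebra if its canonical term algebra is that one; i.e. the closed normal forms are exactly the prescribed canonical terms and each closed term has as its normal form the canonical term denoting the same element of the algebra. Algebras. $\mathbb Q_0$ is the field $\mathbb Q$ with signature $\{0,1,-(\_),(\_)^{-1},+,\cdot\}$, where $(\_)^{-1}$ is the usual inverse on nonzero rationals and $0^{-1}=0$. $\mathbb Q_{\mathbf a}$ is the algebra over the signature $\{0,1,\mathbf a,-(\_),(\_)^{-1},+,\cdot\}$ with domain $\mathbb Q\cup\{\mathbf a\}$, $\mathbf a\notin\mathbb Q$, the usual field operations on $\mathbb Q$, $0^{-1}=\mathbf a$, $-\mathbf a=\mathbf a^{-1}=\mathbf a$, and $x+\mathbf a=\mathbf a+x=x\cdot\mathbf a=\mathbf a\cdot x=\mathbf a$ for all $x$. Canonical terms. Positive numerals are the terms $1$, and $n+1$ for $n$ a positive numeral (so $1,\ 1+1,\ (1+1)+1,\dots$); negative numerals are the terms $-(n)$ with $n$ a positive numeral; a numeral is $0$, a positive numeral or a negative numeral.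 The canonical terms for $\mathbb Q_0$ are the numerals together with all closed terms of the form $n\cdot m^{-1}$ and $(-n)\cdot m^{-1}$ where $n$ is a positive numeral, $m$ is a positive numeral larger than $1$, and $n$ and $m$ (viewed as natural numbers) are relatively prime. The canonical terms for $\mathbb Q_{\mathbf a}$ are the canonical terms for $\mathbb Q_0$ and the constant $\mathbf a$. $\widehat{\mathbb Q_0}$ and $\widehat{\mathbb Q_{\mathbf a}}$ are the canonical term algebras with these canonical terms, representing $\mathbb Q_0$ and $\mathbb Q_{\mathbf a}$ respectively. *)

theory Defs
  imports Complex_Main "HOL-Library.Confluence"
begin

subsection \<open>Terms over a signature\<close>

text \<open>Rewriting systems are finite, so countably many variables suffice.
  A signature is a set of pairs of a function symbol and its arity.\<close>

datatype 'f trm = Var nat | App 'f "'f trm list"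

type_synonym 'f signature = "('f \<times> nat) set"

inductive_set terms_over :: "'f signature \<Rightarrow> 'f trm set" for S where
  Var: "Var x \<in> terms_over S"
| App: "(f, length ts) \<in> S \<Longrightarrow> (\<And>t. t \<in> set ts \<Longrightarrow> t \<in> terms_over S) \<Longrightarrow> App f ts \<in> terms_over S"

fun vars :: "'f trm \<Rightarrow> nat set" where
  "vars (Var x) = {x}"
| "vars (App f ts) = (\<Union>t\<in>set ts. vars t)"

definition closed_terms :: "'f signature \<Rightarrow> 'f trm set" where
  "closed_terms S = {t \<in> terms_over S. vars t = {}}"

fun subst :: "(nat \<Rightarrow> 'f trm) \<Rightarrow> 'f trm \<Rightarrow> 'f trm" where
  "subst \<sigma> (Var x) = \<sigma> x"
| "subst \<sigma> (App f ts) = App f (map (subst \<sigma>) ts)"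


subsection \<open>Rewriting\<close>

type_synonym 'f equations = "('f trm \<times> 'f trm) set"

inductive rewrite_step :: "'f equations \<Rightarrow> 'f trm \<Rightarrow> 'f trm \<Rightarrow> bool" for E where
  root: "(l, r) \<in> E \<Longrightarrow> rewrite_step E (subst \<sigma> l) (subst \<sigma> r)"
| arg: "rewrite_step E s t \<Longrightarrow> rewrite_step E (App f (us @ s # vs)) (App f (us @ t # vs))"

definition closed_step :: "'f signature \<Rightarrow> 'f equations \<Rightarrow> 'f trm \<Rightarrow> 'f trm \<Rightarrow> bool" where
  "closed_step S E s t \<longleftrightarrow> s \<in> closed_terms S \<and> t \<in> closed_terms S \<and> rewrite_step E s t"

definition closed_normal_forms :: "'f signature \<Rightarrow> 'f equations \<Rightarrow> 'f trm set" where
  "closed_normal_forms S E = {t \<in> closed_terms S. \<nexists>u. closed_step S E t u}"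

text \<open>The usual restrictions on rewrite rules (the left-hand side is not a variable, and every
  variable of the right-hand side occurs on the left) are not imposed: they follow from
  termination on closed terms, see \<open>is_DDRS_rule\<close> below.\<close>

definition is_DDRS :: "'f signature \<Rightarrow> 'f equations \<Rightarrow> bool" where
  "is_DDRS S E \<longleftrightarrow>
     finite E \<and> E \<subseteq> terms_over S \<times> terms_over S \<and>
     wfp (closed_step S E)\<inverse>\<inverse> \<and> confluentp (closed_step S E)"


subsection \<open>Algebras\<close>

record ('f, 'a) algebra =
  carrier :: "'a set"
  interp :: "'f \<Rightarrow> 'a list \<Rightarrow> 'a"

fun eval :: "('f, 'a) algebra \<Rightarrow> 'f trm \<Rightarrow> 'a" where
  "eval A (App f ts) = interp A f (map (eval A) ts)"

text \<open>Equality of algebras over a signature; what \<^const>\<open>interp\<close> does outside the carrier or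
  at a wrong number of arguments is immaterial.\<close>

definition same_algebra :: "'f signature \<Rightarrow> ('f, 'a) algebra \<Rightarrow> ('f, 'a) algebra \<Rightarrow> bool" where
  "same_algebra S A B \<longleftrightarrow>
     carrier A = carrier B \<and>
     (\<forall>(f, n) \<in> S. \<forall>as. length as = n \<and> set as \<subseteq> carrier A \<longrightarrow> interp A f as = interp B f as)"

definition canonical_term_algebra :: "'f signature \<Rightarrow> 'f equations \<Rightarrow> ('f, 'f trm) algebra" where
  "canonical_term_algebra S E =
     \<lparr> carrier = closed_normal_forms S E,
       interp = (\<lambda>f ts. THE u. u \<in> closed_normal_forms S E \<and> (closed_step S E)\<^sup>*\<^sup>* (App f ts) u) \<rparr>"

definition is_DDRS_for :: "'f signature \<Rightarrow> 'f equations \<Rightarrow> ('f, 'f trm) algebra \<Rightarrow> bool" where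
  "is_DDRS_for S E A \<longleftrightarrow> is_DDRS S E \<and> same_algebra S (canonical_term_algebra S E) A"

text \<open>The algebra on a set \<open>C\<close> of closed terms that represents \<open>A\<close>; meaningful if every element
  of \<open>A\<close> is denoted by exactly one term in \<open>C\<close>.\<close>

definition representing_algebra :: "'f trm set \<Rightarrow> ('f, 'a) algebra \<Rightarrow> ('f, 'f trm) algebra" where
  "representing_algebra C A =
     \<lparr> carrier = C,
       interp = (\<lambda>f ts. THE u. u \<in> C \<and> eval A u = eval A (App f ts)) \<rparr>"


subsection \<open>The rational numbers with a totalised inverse\<close>

datatype opsym = Zero | One | Err | Neg | Inv | Add | Mul

definition sig_Q0 :: "opsym signature" where
  "sig_Q0 = {(Zero, 0), (One, 0), (Neg, 1), (Inv, 1), (Add, 2), (Mul, 2)}"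

definition sig_Qa :: "opsym signature" where
  "sig_Qa = insert (Err, 0) sig_Q0"

fun Q0_op :: "opsym \<Rightarrow> rat list \<Rightarrow> rat" where
  "Q0_op Zero [] = 0"
| "Q0_op One [] = 1"
| "Q0_op Neg [x] = - x"
| "Q0_op Inv [x] = (if x = 0 then 0 else inverse x)"
| "Q0_op Add [x, y] = x + y"
| "Q0_op Mul [x, y] = x * y"

definition Q0 :: "(opsym, rat) algebra" where
  "Q0 = \<lparr> carrier = UNIV, interp = Q0_op \<rparr>"

text \<open>\<^const>\<open>None\<close> is the extra element \<open>\<a>\<close>, denoted by the constant symbol \<^const>\<open>Err\<close>.\<close>

fun Qa_op :: "opsym \<Rightarrow> rat option list \<Rightarrow> rat option" where
  "Qa_op Zero [] = Some 0"
| "Qa_op One [] = Some 1"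
| "Qa_op Err [] = None"
| "Qa_op Neg [Some x] = Some (- x)"
| "Qa_op Neg [None] = None"
| "Qa_op Inv [Some x] = (if x = 0 then None else Some (inverse x))"
| "Qa_op Inv [None] = None"
| "Qa_op Add [Some x, Some y] = Some (x + y)"
| "Qa_op Add [None, y] = None"
| "Qa_op Add [Some x, None] = None"
| "Qa_op Mul [Some x, Some y] = Some (x * y)"
| "Qa_op Mul [None, y] = None"
| "Qa_op Mul [Some x, None] = None"

definition Qa :: "(opsym, rat option) algebra" where
  "Qa = \<lparr> carrier = UNIV, interp = Qa_op \<rparr>"


subsection \<open>Canonical terms\<close>

text \<open>The positive numerals are \<open>num_term k\<close> for \<open>k \<ge> 1\<close>: \<open>1\<close>, \<open>1 + 1\<close>, \<open>(1 + 1) + 1\<close>, \dots\<close>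

fun num_term :: "nat \<Rightarrow> opsym trm" where
  "num_term 0 = App Zero []"
| "num_term (Suc 0) = App One []"
| "num_term (Suc (Suc k)) = App Add [num_term (Suc k), App One []]"

definition neg_num_term :: "nat \<Rightarrow> opsym trm" where
  "neg_num_term k = App Neg [num_term k]"

definition canonical_Q0 :: "opsym trm set" where
  "canonical_Q0 =
     {num_term 0} \<union> {num_term n | n. n \<ge> 1} \<union> {neg_num_term n | n. n \<ge> 1} \<union>
     {App Mul [num_term n, App Inv [num_term m]] | n m. n \<ge> 1 \<and> m > 1 \<and> coprime n m} \<union>
     {App Mul [neg_num_term n, App Inv [num_term m]] | n m. n \<ge> 1 \<and> m > 1 \<and> coprime n m}"

definition canonical_Qa :: "opsym trm set" where
  "canonical_Qa = insert (App Err []) canonical_Q0"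

definition hat_Q0 :: "(opsym, opsym trm) algebra" where
  "hat_Q0 = representing_algebra canonical_Q0 Q0"

definition hat_Qa :: "(opsym, opsym trm) algebra" where
  "hat_Qa = representing_algebra canonical_Qa Qa"


subsection \<open>Adequacy of the definitions\<close>

text \<open>Rules of a DDRS satisfy the usual restrictions on rewrite rules.\<close>

lemma closed_App_iff:
  "App f ts \<in> closed_terms S \<longleftrightarrow> (f, length ts) \<in> S \<and> set ts \<subseteq> closed_terms S"
  by (auto simp: closed_terms_def intro: terms_over.App elim: terms_over.cases)

lemma subst_closed:
  assumes "t \<in> terms_over S" "\<And>x. \<sigma> x \<in> closed_terms S"
  shows "subst \<sigma> t \<in> closed_terms S"
  using assms(1)
proof induction
  case (Var x)
  then show ?case using assms(2) by simp
next
  case (App f ts)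
  then show ?case by (auto simp: closed_App_iff)
qed

inductive subterm :: "'f trm \<Rightarrow> 'f trm \<Rightarrow> bool" where
  refl: "subterm t t"
| arg: "subterm s t \<Longrightarrow> t \<in> set ts \<Longrightarrow> subterm s (App f ts)"

lemma subterm_subst: "x \<in> vars t \<Longrightarrow> subterm (\<sigma> x) (subst \<sigma> t)"
proof (induction t)
  case (App f ts)
  then obtain t where "t \<in> set ts" "subterm (\<sigma> x) (subst \<sigma> t)" by auto
  then show ?case by (auto intro: subterm.arg)
qed (auto intro: subterm.refl)

lemma subterm_trans: "subterm t u \<Longrightarrow> subterm s t \<Longrightarrow> subterm s u"
  by (induction rule: subterm.induct) (auto intro: subterm.intros)

lemma subterm_step:
  assumes "subterm s t" "rewrite_step E s s'" "s' \<in> closed_terms S" "t \<in> closed_terms S"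
  shows "\<exists>t' \<in> closed_terms S. rewrite_step E t t' \<and> subterm s' t'"
  using assms
proof induction
  case (refl t)
  then show ?case by (auto intro: subterm.intros)
next
  case (arg s t ts f)
  from arg.hyps obtain us vs where ts: "ts = us @ t # vs" by (meson split_list)
  with arg.prems have "t \<in> closed_terms S" by (auto simp: closed_App_iff)
  with arg obtain t' where t': "t' \<in> closed_terms S" "rewrite_step E t t'" "subterm s' t'"
    by blast
  have "App f (us @ t' # vs) \<in> closed_terms S"
    using arg.prems t' by (auto simp: closed_App_iff ts)
  moreover have "rewrite_step E (App f ts) (App f (us @ t' # vs))"
    unfolding ts using t'(2) by (rule rewrite_step.arg)
  moreover have "subterm s' (App f (us @ t' # vs))"
    using t'(3) by (rule subterm.arg) simp
  ultimately show ?case by blast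
qed

lemma no_self_embedding_step:
  assumes "wfp (closed_step S E)\<inverse>\<inverse>" "s \<in> closed_terms S" "s' \<in> closed_terms S"
    "rewrite_step E s s'"
  shows "\<not> subterm s s'"
proof
  assume sub: "subterm s s'"
  let ?B = "{t \<in> closed_terms S. subterm s t}"
  have "s \<in> ?B" using assms(2) by (auto intro: subterm.intros)
  then obtain z where z: "z \<in> ?B" "\<And>y. closed_step S E z y \<Longrightarrow> y \<notin> ?B"
    using assms(1)[unfolded wfp_iff_ex_minimal, rule_format, of ?B] by auto
  from z(1) obtain t' where "t' \<in> closed_terms S" "rewrite_step E z t'" "subterm s' t'"
    using subterm_step assms by blast
  with z sub show False by (auto simp: closed_step_def intro: subterm_trans)
qed

lemma is_DDRS_rule:
  assumes E: "is_DDRS S E" "(l, r) \<in> E" and c: "c \<in> closed_terms S"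
  shows "l \<notin> range Var \<and> vars r \<subseteq> vars l"
proof -
  have lr: "l \<in> terms_over S" "r \<in> terms_over S" and wf: "wfp (closed_step S E)\<inverse>\<inverse>"
    using E by (auto simp: is_DDRS_def)
  have nsub: "\<not> subterm (subst \<sigma> l) (subst \<sigma> r)" if "\<And>x. \<sigma> x \<in> closed_terms S" for \<sigma>
    by (rule no_self_embedding_step[OF wf _ _ rewrite_step.root[OF E(2)]])
      (simp_all add: subst_closed lr that)
  have fresh: "vars r \<subseteq> vars l"
  proof
    fix x assume x: "x \<in> vars r"
    show "x \<in> vars l"
    proof (rule ccontr)
      assume "x \<notin> vars l"
      define \<sigma> where "\<sigma> = (\<lambda>y. if y = x then subst (\<lambda>_. c) l else c)"
      have agree: "subst \<sigma> t = subst (\<lambda>_. c) t" if "x \<notin> vars t" for t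
        using that by (induction t) (auto simp: \<sigma>_def)
      have "\<And>y. \<sigma> y \<in> closed_terms S" using c subst_closed[OF lr(1)] by (auto simp: \<sigma>_def)
      moreover have "\<sigma> x = subst \<sigma> l" using agree[OF \<open>x \<notin> vars l\<close>] by (simp add: \<sigma>_def)
      ultimately show False using nsub subterm_subst[OF x, of \<sigma>] by metis
    qed
  qed
  moreover have "l \<noteq> Var x" for x
  proof
    assume l: "l = Var x"
    show False
    proof (cases "x \<in> vars r")
      case True
      then show False using nsub[of "\<lambda>_. c"] subterm_subst[OF True, of "\<lambda>_. c"] c l by auto
    next
      case False
      define \<sigma> where "\<sigma> = (\<lambda>y::nat. subst (\<lambda>_. c) r)"
      have "vars r = {}" using fresh False l by auto
      then have *: "subst \<sigma> r = subst (\<lambda>_. c) r" for \<sigma>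
      proof -
        have "vars t = {} \<Longrightarrow> subst \<sigma> t = subst (\<lambda>_. c) t" for t :: "'a trm"
          by (induction t) auto
        with \<open>vars r = {}\<close> show ?thesis by blast
      qed
      have "\<And>y. \<sigma> y \<in> closed_terms S" using c subst_closed[OF lr(2)] by (auto simp: \<sigma>_def)
      then show False using nsub[of \<sigma>] *[of \<sigma>] l by (auto simp: \<sigma>_def intro: subterm.refl)
    qed
  qed
  ultimately show ?thesis by blast
qed

text \<open>The canonical terms are closed terms over the signature, and evaluation is a bijection
  from them onto the represented algebra.\<close>

lemma num_term_closed: "num_term k \<in> closed_terms sig_Q0"
  by (induction k rule: num_term.induct) (auto simp: closed_App_iff sig_Q0_def)

lemma canonical_Q0_closed: "canonical_Q0 \<subseteq> closed_terms sig_Q0"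
  using num_term_closed
  by (auto simp: canonical_Q0_def neg_num_term_def closed_App_iff) (auto simp: sig_Q0_def)

lemma closed_terms_mono:
  assumes "S \<subseteq> S'" "t \<in> closed_terms S"
  shows "t \<in> closed_terms S'"
  using assms(2)
proof (induction t)
  case (Var x)
  then show ?case by (simp add: closed_terms_def)
next
  case (App f ts)
  then show ?case using assms(1) by (auto simp: closed_App_iff)
qed

lemma canonical_Qa_closed: "canonical_Qa \<subseteq> closed_terms sig_Qa"
proof -
  have "sig_Q0 \<subseteq> sig_Qa" by (auto simp: sig_Qa_def)
  then have "canonical_Q0 \<subseteq> closed_terms sig_Qa"
    using canonical_Q0_closed closed_terms_mono by blast
  moreover have "App Err [] \<in> closed_terms sig_Qa"
    by (simp add: closed_App_iff sig_Qa_def)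
  ultimately show ?thesis by (simp add: canonical_Qa_def)
qed

lemma eval_num_term: "eval Q0 (num_term k) = of_nat k"
  by (induction k rule: num_term.induct) (auto simp: Q0_def)

lemma eval_Qa_num_term: "eval Qa (num_term k) = Some (of_nat k)"
  by (induction k rule: num_term.induct) (auto simp: Qa_def)

lemma eval_Qa_canonical: "t \<in> canonical_Q0 \<Longrightarrow> eval Qa t = Some (eval Q0 t)"
  using eval_num_term eval_Qa_num_term
  by (auto simp: canonical_Q0_def neg_num_term_def) (auto simp: Q0_def Qa_def)

definition canonical_of :: "rat \<Rightarrow> opsym trm" where
  "canonical_of q = (let (a, b) = quotient_of q;
       s = (if a < 0 then neg_num_term else num_term) (nat \<bar>a\<bar>)
     in if b = 1 then s else App Mul [s, App Inv [num_term (nat b)]])"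

lemma quotient_of_frac:
  "b > 0 \<Longrightarrow> coprime a b \<Longrightarrow> quotient_of (of_int a / of_int b) = (a, b)"
  by (simp add: quotient_of_Fract flip: Fract_of_int_quotient)

lemma eval_neg_num_term: "eval Q0 (neg_num_term k) = - of_nat k"
  using eval_num_term[of k] by (simp add: neg_num_term_def Q0_def)

lemma eval_frac: "eval Q0 (App Mul [s, App Inv [t]]) = eval Q0 s / eval Q0 t"
  by (simp add: Q0_def divide_inverse)

lemma canonical_of_eval:
  assumes "t \<in> canonical_Q0"
  shows "canonical_of (eval Q0 t) = t"
proof -
  have nat: "quotient_of (of_nat n) = (int n, 1)" for n
    using quotient_of_frac[of 1 "int n"] by simp
  have neg: "quotient_of (- of_nat n) = (- int n, 1)" for n
    using quotient_of_frac[of 1 "- int n"] by simp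
  have frac: "quotient_of (of_nat n / of_nat m) = (int n, int m)" if "m > 1" "coprime n m" for n m
    using quotient_of_frac[of "int m" "int n"] that by simp
  have nfrac: "quotient_of (- (of_nat n / of_nat m)) = (- int n, int m)" if "m > 1" "coprime n m" for n m
    using quotient_of_frac[of "int m" "- int n"] that by simp
  from assms consider (zero) "t = num_term 0"
    | (pos) n where "t = num_term n" | (neg) n where "t = neg_num_term n" "n \<ge> 1"
    | (frac) n m where "t = App Mul [num_term n, App Inv [num_term m]]" "m > 1" "coprime n m"
    | (nfrac) n m where "t = App Mul [neg_num_term n, App Inv [num_term m]]" "n \<ge> 1" "m > 1" "coprime n m"
    unfolding canonical_Q0_def by blast
  then show ?thesis
  proof cases
    case zero
    then show ?thesis using nat[of 0] by (simp add: canonical_of_def eval_num_term del: num_term.simps)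
  next
    case (pos n)
    then show ?thesis by (simp add: canonical_of_def eval_num_term nat)
  next
    case (neg n)
    then show ?thesis by (simp add: canonical_of_def eval_neg_num_term \<open>\<And>n. quotient_of (- of_nat n) = _\<close>)
  next
    case (frac n m)
    then show ?thesis
      by (simp add: canonical_of_def eval_num_term eval_frac \<open>\<And>n m. _ \<Longrightarrow> _ \<Longrightarrow> quotient_of (of_nat n / of_nat m) = _\<close> del: eval.simps)
  next
    case (nfrac n m)
    then show ?thesis
      by (simp add: canonical_of_def eval_num_term eval_neg_num_term eval_frac
          \<open>\<And>n m. _ \<Longrightarrow> _ \<Longrightarrow> quotient_of (- (of_nat n / of_nat m)) = _\<close> del: eval.simps)
  qed
qed

lemma eval_canonical_of: "canonical_of q \<in> canonical_Q0 \<and> eval Q0 (canonical_of q) = q"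
proof -
  obtain a b where ab: "quotient_of q = (a, b)" by force
  then have b: "b > 0" and cop: "coprime a b" and q: "q = of_int a / of_int b"
    by (auto dest: quotient_of_denom_pos quotient_of_coprime quotient_of_div)
  define n m where nm: "n = nat \<bar>a\<bar>" "m = nat b"
  have copnm: "coprime n m" using cop b unfolding nm
    by (simp flip: coprime_int_iff)
  define s where "s = (if a < 0 then neg_num_term else num_term) n"
  have ev: "eval Q0 s = of_int a" "eval Q0 (num_term m) = of_int b"
    using b by (auto simp: s_def nm eval_neg_num_term eval_num_term)
  have c: "canonical_of q = (if b = 1 then s else App Mul [s, App Inv [num_term m]])"
    by (simp add: canonical_of_def ab s_def nm)
  have "b \<noteq> 1 \<Longrightarrow> n \<ge> 1 \<and> m > 1" using b cop by (cases "a = 0") (auto simp: nm)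
  moreover have "a < 0 \<Longrightarrow> n \<ge> 1" by (auto simp: nm)
  moreover have "n = 0 \<or> n \<ge> 1" by auto
  ultimately have "canonical_of q \<in> canonical_Q0"
    using copnm unfolding c s_def canonical_Q0_def by auto
  moreover have "eval Q0 (canonical_of q) = q"
    using ev by (simp add: c eval_frac q[symmetric] del: eval.simps) (simp add: q)
  ultimately show ?thesis by blast
qed

lemma bij_betw_eval_Q0: "bij_betw (eval Q0) canonical_Q0 (carrier Q0)"
  by (rule bij_betw_byWitness[where f' = canonical_of])
    (use canonical_of_eval eval_canonical_of in \<open>auto simp: Q0_def\<close>)

lemma bij_betw_eval_Qa: "bij_betw (eval Qa) canonical_Qa (carrier Qa)"
proof -
  have "bij_betw (eval Qa) canonical_Q0 (Some ` UNIV)"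
  proof (subst bij_betw_cong[OF eval_Qa_canonical])
    show "bij_betw (\<lambda>t. Some (eval Q0 t)) canonical_Q0 (range Some)"
      using bij_betw_trans[OF bij_betw_eval_Q0, of Some "range Some"]
      by (simp add: Q0_def comp_def bij_betw_def)
  qed
  moreover have "eval Qa (App Err []) = None" by (simp add: Qa_def)
  moreover have "App Err [] \<notin> canonical_Q0"
    using eval_Qa_canonical calculation(2) by fastforce
  ultimately have "bij_betw (eval Qa) (insert (App Err []) canonical_Q0) (insert None (range Some))"
    by (auto simp: bij_betw_def)
  then show ?thesis by (simp add: canonical_Qa_def Qa_def UNIV_option_conv)
qed

end

theory Submission
  imports Defs
begin

text \<open>Normal forms are closed under subterms, canonical terms are not: \<open>1 \<cdot> (1 + 1)\<^sup>-\<^sup>1\<close> is canonical,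
  whereas its subterm \<open>(1 + 1)\<^sup>-\<^sup>1\<close> is not.\<close>

lemma closed_normal_forms_arg:
  assumes "App f ts \<in> closed_normal_forms S E" "t \<in> set ts"
  shows "t \<in> closed_normal_forms S E"
proof -
  have App: "App f ts \<in> closed_terms S" "\<And>u. \<not> closed_step S E (App f ts) u"
    using assms(1) by (auto simp: closed_normal_forms_def)
  then have t: "t \<in> closed_terms S"
    using assms(2) by (auto simp: closed_App_iff)
  have False if u: "closed_step S E t u" for u
  proof -
    from assms(2) obtain us vs where ts: "ts = us @ t # vs" by (meson split_list)
    \<comment> \<open>A step from the argument \<open>t\<close> lifts to the whole term; the result
      is again closed, since replacing one argument by a closed term keeps the arity.\<close>
    have "closed_step S E (App f ts) (App f (us @ u # vs))"
      using App(1) u unfolding ts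
      by (auto simp: closed_step_def closed_App_iff intro: rewrite_step.arg)
    with App(2) show False by blast
  qed
  with t show ?thesis by (auto simp: closed_normal_forms_def)
qed

text \<open>Being the same algebra forces the carrier of \<open>A\<close> to be the set of closed
  normal forms, so it inherits closure under arguments.\<close>

lemma DDRS_for_carrier_arg:
  assumes "is_DDRS_for S E A" "App f ts \<in> carrier A" "t \<in> set ts"
  shows "t \<in> carrier A"
proof -
  have "carrier A = closed_normal_forms S E"
    using assms(1)
    by (simp add: is_DDRS_for_def same_algebra_def canonical_term_algebra_def)
  with assms(2,3) show ?thesis using closed_normal_forms_arg by metis
qed

lemma half_canonical: "App Mul [num_term 1, App Inv [num_term 2]] \<in> canonical_Q0"
proof -
  have "coprime (1::nat) 2" by simp
  then show ?thesis unfolding canonical_Q0_def by fastforce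
qed

text \<open>The head symbol of a canonical term is \<open>Zero\<close>, \<open>One\<close>,
  \<open>Add\<close>, \<open>Neg\<close> or \<open>Mul\<close>; \<open>Inv\<close> occurs only below
  a \<open>Mul\<close>.\<close>

lemma Inv_not_canonical: "App Inv [t] \<notin> canonical_Q0"
proof -
  have "num_term n \<noteq> App Inv [t]" for n by (cases n rule: num_term.cases) auto
  then show ?thesis by (auto simp: canonical_Q0_def neg_num_term_def) metis
qed

theorem theorem3p2p2:
  shows "(\<nexists>E. is_DDRS_for sig_Q0 E hat_Q0) \<and> (\<nexists>E. is_DDRS_for sig_Qa E hat_Qa)"
proof -
  \<comment> \<open>One argument serves both algebras: \<open>canonical_Qa\<close> adds only the
    constant \<open>App Err []\<close>, which is not an inverse either.\<close>
  have "\<not> is_DDRS_for S E A"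
    if A: "carrier A = canonical_Q0 \<or> carrier A = canonical_Qa"
    for S E and A :: "(opsym, opsym trm) algebra"
  proof
    assume "is_DDRS_for S E A"
    moreover have "App Mul [num_term 1, App Inv [num_term 2]] \<in> carrier A"
      using A half_canonical by (auto simp: canonical_Qa_def)
    ultimately have "App Inv [num_term 2] \<in> carrier A"
      by (rule DDRS_for_carrier_arg) simp
    with A Inv_not_canonical show False by (auto simp: canonical_Qa_def)
  qed
  then show ?thesis by (auto simp: hat_Q0_def hat_Qa_def representing_algebra_def)
qed

end
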